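(* Let $D$ be a regular $(v,k,\lambda,\mu)$-PDS in a finite group $G$ with $0<\mu<k$ and $\sqrt\Delta\in\mathbb{Z}$. Let $p$ be a prime dividing $|G|$ with $p\nmid\sqrt\Delta$, let $\alpha\in\{1,2\}$ be such that $p\in\Pi_\alpha$, and let $\beta$ be the other index. Suppose $p$ divides $|G:G'|$ (the order of the group of linear characters of $G$), and let $P$ be a Sylow $p$-subgroup of $G$. Then $\gcd(|N_G(P)|,\pi_\beta)=1$. Moreover, if $G$ is solvable, then $\pi_\beta\equiv1\pmod p$.
   Context: A $(v,k,\lambda,\mu)$-PDS in a group $G$ of order $v$ is a $k$-subset $D$ such that every nonidentity element of $D$ is $xy^{-1}$ ($x,y\in D$) in exactly $\lambda$ ways and every nonidentity element of $G\setminus D$ in exactly $\mu$ ways; regular means $D=D^{(-1)}$ and $1\notin D$. $\Delta=(\lambda-\mu)^2+4(k-\mu)$, $\theta_{1,2}=\frac12(\lambda-\mu\pm\sqrt\Delta)$. For $i\in\{1,2\}$, $\Pi_i$ is the set of primes $p$ with $p\mid v$, $p\nmid\sqrt\Delta$ and $p\mid k-\theta_i$ (each prime dividing $v$ but not $\sqrt\Delta$ lies in exactly one $\Pi_i$), and $\pi_i=\prod_{p\in\Pi_i}p^{e_p}$ where $p^{e_p}$ is the exact power of $p$ dividing $v$. $G'$ is the derived subgroup. *)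

theory Defs
  imports "HOL-Algebra.Algebra" "HOL-Computational_Algebra.Primes"
begin

definition is_PDS :: "('a, 'b) monoid_scheme \<Rightarrow> 'a set \<Rightarrow> nat \<Rightarrow> nat \<Rightarrow> nat \<Rightarrow> nat \<Rightarrow> bool" where
  "is_PDS G D v k lam mu \<longleftrightarrow>
     D \<subseteq> carrier G \<and> order G = v \<and> card D = k \<and>
     (\<forall>g \<in> carrier G. g \<noteq> \<one>\<^bsub>G\<^esub> \<longrightarrow>
        card {(x, y). x \<in> D \<and> y \<in> D \<and> x \<otimes>\<^bsub>G\<^esub> inv\<^bsub>G\<^esub> y = g}
          = (if g \<in> D then lam else mu))"

definition is_regular_PDS :: "('a, 'b) monoid_scheme \<Rightarrow> 'a set \<Rightarrow> nat \<Rightarrow> nat \<Rightarrow> nat \<Rightarrow> nat \<Rightarrow> bool" where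
  "is_regular_PDS G D v k lam mu \<longleftrightarrow>
     is_PDS G D v k lam mu \<and> (\<lambda>x. inv\<^bsub>G\<^esub> x) ` D = D \<and> \<one>\<^bsub>G\<^esub> \<notin> D"

definition PDS_Delta :: "nat \<Rightarrow> nat \<Rightarrow> nat \<Rightarrow> int" where
  "PDS_Delta k lam mu = (int lam - int mu)^2 + 4 * (int k - int mu)"

text \<open>theta_1, theta_2 = (lambda - mu +- sqrt Delta)/2, where s = sqrt Delta (a nonnegative integer).
  When Delta = s^2, lambda - mu + s and lambda - mu - s are even, so the division is exact.\<close>
definition PDS_theta :: "nat \<Rightarrow> nat \<Rightarrow> int \<Rightarrow> nat \<Rightarrow> int" where
  "PDS_theta lam mu s i = (if i = 1 then (int lam - int mu + s) div 2 else (int lam - int mu - s) div 2)"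

definition PDS_Pi :: "nat \<Rightarrow> nat \<Rightarrow> nat \<Rightarrow> nat \<Rightarrow> int \<Rightarrow> nat \<Rightarrow> nat set" where
  "PDS_Pi v k lam mu s i = {p. Factorial_Ring.prime p \<and> p dvd v \<and> \<not> int p dvd s \<and>
                              int p dvd (int k - PDS_theta lam mu s i)}"

definition PDS_pi :: "nat \<Rightarrow> nat \<Rightarrow> nat \<Rightarrow> nat \<Rightarrow> int \<Rightarrow> nat \<Rightarrow> nat" where
  "PDS_pi v k lam mu s i = (\<Prod>p \<in> PDS_Pi v k lam mu s i. p ^ multiplicity p v)"

definition sylow_subgroup :: "('a, 'b) monoid_scheme \<Rightarrow> nat \<Rightarrow> 'a set \<Rightarrow> bool" where
  "sylow_subgroup G p P \<longleftrightarrow> subgroup P G \<and> card P = p ^ multiplicity p (order G)"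

end

theory Submission
  imports Defs
begin

text \<open>
  Write \<open>\<theta>\<^sub>i\<close> for the nontrivial eigenvalues and let \<open>p \<in> \<Pi>\<^sub>i\<close>. In the integral group ring the element
  \<open>w = D - \<theta>\<^sub>i\<close> satisfies \<open>w\<^sup>2 = \<delta>w + \<mu>G\<close> with \<open>\<delta> = \<plusminus>\<surd>\<Delta>\<close> prime to \<open>p\<close>, and its augmentation \<open>k - \<theta>\<^sub>i\<close> is
  divisible by \<open>p\<close>; so its powers are known explicitly. Let \<open>C\<close> be a class of elements of order
  divisible by \<open>p\<close>. The sum over \<open>C\<close> of the coefficients of \<open>w\<close> to the power \<open>p\<^sup>n\<close> is a sum over words of
  length \<open>p\<^sup>n\<close>, on which rotation acts; a short orbit would consist of high \<open>p\<close>-th powers of words,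
  whose product has order prime to \<open>p\<close>. Hence a growing power of \<open>p\<close> divides this sum, and letting
  \<open>n\<close> tend to infinity gives \<open>v |D \<inter> C| = (k - \<theta>\<^sub>i) |C|\<close>. (In terms of characters: \<open>w\<close> is
  \<open>p\<close>-integrally an idempotent up to scaling, and projective characters vanish on \<open>p\<close>-singular
  elements.) As \<open>\<theta>\<^sub>1 \<noteq> \<theta>\<^sub>2\<close>, no element has order divisible by both \<open>p \<in> \<Pi>\<^sub>\<alpha>\<close> and \<open>q \<in> \<Pi>\<^sub>\<beta>\<close>.

  An element \<open>y \<in> N\<^sub>G(P)\<close> of order \<open>q\<close> permutes the \<open>p\<close>-power many elements of \<open>P \<inter> xG'\<close> for
  \<open>x \<in> P - G'\<close>, so it commutes with one of them, which is impossible. In the solvable case, \<open>P\<close> acts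
  on the Sylow \<open>q\<close>-subgroup of each factor of the derived series; by a Frattini argument a fixed point
  comes from \<open>N\<^sub>G(P)\<close>, whose order is prime to \<open>q\<close>, so only the identity is fixed.
\<close>

section \<open>Orbits of a map of prime-power period\<close>

text \<open>The orbits of \<open>f\<close> partition \<open>L\<close>. Each has length equal to the
  least period of its points, which divides \<open>p ^ n\<close> and so is a power of
  \<open>p\<close>; as \<open>p ^ j\<close> is not a period, this power exceeds
  \<open>p ^ j\<close>.\<close>

lemma dvd_card_if_least_period:
  fixes f :: "'a \<Rightarrow> 'a"
  assumes p: "Factorial_Ring.prime (p::nat)" and fin: "finite L" and cl: "\<And>l. l \<in> L \<Longrightarrow> f l \<in> L"
    and per: "\<And>l. l \<in> L \<Longrightarrow> (f ^^ (p ^ n)) l = l"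
    and nper: "\<And>l. l \<in> L \<Longrightarrow> (f ^^ (p ^ j)) l \<noteq> l"
  shows "p ^ Suc j dvd card L"
proof -
  define r where "r = {(x, y). x \<in> L \<and> y \<in> L \<and> (\<exists>i. (f ^^ i) x = y)}"
  have clp: "(f ^^ i) l \<in> L" if "l \<in> L" for i l
    using that by (induction i) (auto simp: cl)
  have perk: "(f ^^ (p ^ n * k)) l = l" if "l \<in> L" for k l
    using per[OF that] by (induction k) (auto simp: funpow_add)
  have symr: "(y, x) \<in> r" if "(x, y) \<in> r" for x y
  proof -
    from that obtain i where i: "x \<in> L" "y \<in> L" "(f ^^ i) x = y" by (auto simp: r_def)
    have "0 < p ^ n" using p by (simp add: prime_gt_0_nat)
    then have "i \<le> p ^ n * i" 
      by (metis One_nat_def Suc_leI mult_1 mult_le_mono1)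
    \<comment> \<open>\<open>p ^ n * i\<close> is a period of \<open>x\<close>, so the remaining
      \<open>p ^ n * i - i\<close> steps lead from \<open>y\<close> back to
      \<open>x\<close>.\<close>
    then have "(f ^^ (p ^ n * i - i)) y = (f ^^ (p ^ n * i)) x"
      unfolding i(3)[symmetric] by (metis comp_apply funpow_add le_add_diff_inverse2)
    then show ?thesis using i perk by (auto simp: r_def)
  qed
  have eq: "equiv L r"
  proof (rule equivI)
    show "r \<subseteq> L \<times> L" by (auto simp: r_def)
    show "refl_on L r" by (auto simp: refl_on_def r_def intro: exI[of _ 0])
    show "sym r" using symr by (auto intro: symI)
    show "trans r"
    proof (rule transI)
      fix x y z assume "(x, y) \<in> r" "(y, z) \<in> r"
      then obtain i i' where "x \<in> L" "z \<in> L" "(f ^^ i') ((f ^^ i) x) = z" by (auto simp: r_def)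
      then show "(x, z) \<in> r"
        by (auto simp: r_def funpow_add intro!: exI[of _ "i' + i"])
    qed
  qed
  have "p ^ Suc j dvd card B" if B: "B \<in> L // r" for B
  proof -
    from B obtain l where l: "l \<in> L" "B = r `` {l}" by (auto elim: quotientE)
    \<comment> \<open>The least positive period of \<open>l\<close>. The points
      \<open>(f ^^ i) l\<close> with \<open>i < d\<close> are distinct and exhaust the orbit, so
      \<open>d\<close> is its size.\<close>
    define d where "d = (LEAST d. 0 < d \<and> (f ^^ d) l = l)"
    have ex: "0 < p ^ n \<and> (f ^^ (p ^ n)) l = l"
      using p per l by (auto simp: prime_gt_0_nat)
    have d: "0 < d" "(f ^^ d) l = l"
      using LeastI[of "\<lambda>d. 0 < d \<and> (f ^^ d) l = l", OF ex] unfolding d_def by auto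
    have dleast: "d \<le> m" if "0 < m" "(f ^^ m) l = l" for m
      unfolding d_def using that by (intro Least_le) auto
    have dk: "(f ^^ (k * d)) l = l" for k
      using d by (induction k) (auto simp: funpow_add)
    have modd: "(f ^^ m) l = (f ^^ (m mod d)) l" for m
    proof -
      have "(f ^^ m) l = (f ^^ (m mod d + m div d * d)) l" by simp
      also have "\<dots> = (f ^^ (m mod d)) l" unfolding funpow_add using dk by simp
      finally show ?thesis .
    qed
    have ddvd: "d dvd m \<longleftrightarrow> (f ^^ m) l = l" for m
      using modd[of m] dleast[of "m mod d"] d(1) mod_less_divisor[of d m]
      by (metis dk dvd_div_mult_self dvd_eq_mod_eq_0 funpow_0 not_gr0 not_less)
    have Bim: "B = (\<lambda>i. (f ^^ i) l) ` {..<d}"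
    proof
      show "B \<subseteq> (\<lambda>i. (f ^^ i) l) ` {..<d}"
      proof
        fix y assume "y \<in> B"
        then obtain i where "y = (f ^^ i) l" unfolding l(2) r_def by auto
        then have "y = (f ^^ (i mod d)) l" using modd by simp
        then show "y \<in> (\<lambda>i. (f ^^ i) l) ` {..<d}" using d(1) by auto
      qed
      show "(\<lambda>i. (f ^^ i) l) ` {..<d} \<subseteq> B"
        using l clp by (auto simp: r_def)
    qed
    have "inj_on (\<lambda>i. (f ^^ i) l) {..<d}"
    proof (rule linorder_inj_onI)
      fix a b assume ab: "a < b" "a \<in> {..<d}" "b \<in> {..<d}"
      show "(f ^^ a) l \<noteq> (f ^^ b) l"
      proof
        assume "(f ^^ a) l = (f ^^ b) l"
        then have "(f ^^ (d - b)) ((f ^^ a) l) = (f ^^ (d - b)) ((f ^^ b) l)" by simp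
        then have "(f ^^ (d - b + a)) l = (f ^^ (d - b + b)) l" by (simp only: funpow_add comp_apply)
        then have "(f ^^ (d - b + a)) l = l" using ab d by simp
        then have "d \<le> d - b + a" using ab by (intro dleast) auto
        then show False using ab by auto
      qed
    qed auto
    then have card: "card B = d" unfolding Bim by (simp add: card_image)
    have "d dvd p ^ n" using ddvd per l by simp
    then obtain i where i: "d = p ^ i" using p divides_primepow_nat by blast
    have "\<not> i \<le> j" using nper[OF l(1)] ddvd[of "p ^ j"] unfolding i by (auto simp: le_imp_power_dvd)
    then show ?thesis unfolding card i by (intro le_imp_power_dvd) auto
  qed
  then show ?thesis by (rule equiv_imp_dvd_card[OF fin eq])
qed

section \<open>Words and class sums in the group ring\<close>

definition words :: "('a, 'b) monoid_scheme \<Rightarrow> nat \<Rightarrow> 'a list set" where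
  "words G n = {l. length l = n \<and> set l \<subseteq> carrier G}"

definition word_prod :: "('a, 'b) monoid_scheme \<Rightarrow> 'a list \<Rightarrow> 'a" where
  "word_prod G l = foldr (\<otimes>\<^bsub>G\<^esub>) l \<one>\<^bsub>G\<^esub>"

context group
begin

lemma word_prod_simps [simp]:
  "word_prod G [] = \<one>" "word_prod G (x # l) = x \<otimes> word_prod G l"
  by (simp_all add: word_prod_def)

lemma word_prod_closed [simp]: "set l \<subseteq> carrier G \<Longrightarrow> word_prod G l \<in> carrier G"
  by (induction l) auto

lemma word_prod_append:
  "set l \<subseteq> carrier G \<Longrightarrow> set l' \<subseteq> carrier G \<Longrightarrow>
    word_prod G (l @ l') = word_prod G l \<otimes> word_prod G l'"
  by (induction l) (auto simp: m_assoc)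

lemma word_prod_replicate:
  "set l \<subseteq> carrier G \<Longrightarrow> word_prod G (concat (replicate n l)) = word_prod G l [^] n"
proof (induction n)
  case (Suc n)
  then show ?case using nat_pow_Suc2[of "word_prod G l" n]
    by (auto simp: word_prod_append set_replicate_conv_if)
qed simp

text \<open>Moving the first letter to the end conjugates the product by the inverse of that letter.
  Hence rotation preserves the condition that a product lies in a given union of conjugacy
  classes.\<close>

lemma word_prod_rotate1:
  assumes "set l \<subseteq> carrier G"
  shows "\<exists>x \<in> carrier G. word_prod G (rotate1 l) = x \<otimes> word_prod G l \<otimes> inv x"
proof (cases l)
  case Nil then show ?thesis by (auto intro!: bexI[of _ "\<one>"])
next
  case (Cons x t)
  then show ?thesis using assms
    by (intro bexI[of _ "inv x"]) (auto simp: word_prod_append m_assoc[symmetric])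
qed

lemma finite_words: "finite (carrier G) \<Longrightarrow> finite (words G n)"
  using finite_lists_length_eq[of "carrier G" n] by (simp add: words_def conj_commute)

text \<open>If rotation by \<open>d\<close> fixes \<open>l = u @ t\<close>, then \<open>u\<close>
  and \<open>t\<close> commute as words and so are repetitions of one word \<open>z\<close>. The
  product of \<open>l\<close> is then an explicit power of the product of \<open>z\<close>.\<close>

lemma word_prod_periodic:
  assumes l: "set l \<subseteq> carrier G" "length l = d * m" and rot: "rotate d l = l"
  shows "\<exists>x \<in> carrier G. word_prod G l = x [^] m"
proof (cases "m = 0 \<or> d = 0")
  case True
  then have "l = []" using l by auto
  then show ?thesis by (auto intro!: bexI[of _ "\<one>"])
next
  case False
  then have dle: "d \<le> length l" using l by simp
  define u t where "u = take d l" and "t = drop d l"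
  have ut: "l = u @ t" "length u = d" using dle by (auto simp: u_def t_def)
  have "rotate d l = t @ u" using rotate_append[of u t] ut by simp
  then have "u @ t = t @ u" using rot ut by simp
  then obtain i j z where z: "concat (replicate i z) = u" "concat (replicate j z) = t"
    using comm_append_are_replicate by blast
  have lz: "concat (replicate (i + j) z) = l"
    using z ut by (simp add: replicate_add)
  \<comment> \<open>Comparing lengths gives \<open>(i + j) * length z = i * length z * m\<close>,
    where \<open>length z\<close> is nonzero because \<open>d\<close> is. So \<open>l\<close> is
    \<open>z\<close> repeated \<open>i * m\<close> times.\<close>
  have lens: "i * length z = d" "(i + j) * length z = d * m"
    using z(1) lz ut(2) l(2) by (auto simp: length_concat sum_list_replicate)
  then have "i + j = i * m" using False
    by (metis mult.assoc mult.commute mult_cancel1 mult_zero_right)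
  then have lz': "concat (replicate (i * m) z) = l" using lz by simp
  have "0 < i" "0 < m" using lens False by auto
  then have "i * m \<noteq> 0" by simp
  then have "set z \<subseteq> set l" unfolding lz'[symmetric] by auto
  then have "set z \<subseteq> carrier G" using l by auto
  then show ?thesis unfolding lz'[symmetric]
    by (intro bexI[of _ "word_prod G z [^] i"]) (auto simp: word_prod_replicate nat_pow_pow)
qed

end

section \<open>Coefficients of powers in the integral group ring\<close>

text \<open>The coefficient at \<open>g\<close> of the \<open>n\<close>-th power of the group ring
  element with coefficients \<open>w\<close>. It is left expanded into words so that rotation can
  act on the terms.\<close>

definition word_sum :: "('a, 'b) monoid_scheme \<Rightarrow> ('a \<Rightarrow> int) \<Rightarrow> nat \<Rightarrow> 'a \<Rightarrow> int" where
  "word_sum G w n g = (\<Sum>l\<in>{l \<in> words G n. word_prod G l = g}. prod_list (map w l))"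

context group
begin

lemma word_sum_0: "word_sum G w 0 g = (if g = \<one> then 1 else 0)"
proof -
  have "{l \<in> words G 0. word_prod G l = g} = (if g = \<one> then {[]} else {})"
    by (auto simp: words_def)
  then show ?thesis by (simp add: word_sum_def)
qed

lemma word_sum_Suc:
  assumes fin: "finite (carrier G)" and g: "g \<in> carrier G"
  shows "word_sum G w (Suc n) g = (\<Sum>h\<in>carrier G. w h * word_sum G w n (inv h \<otimes> g))"
proof -
  have "(\<Sum>h\<in>carrier G. w h * word_sum G w n (inv h \<otimes> g)) =
      (\<Sum>(h, l)\<in>(SIGMA h:carrier G. {l \<in> words G n. word_prod G l = inv h \<otimes> g}).
        w h * prod_list (map w l))"
    unfolding word_sum_def sum_distrib_left
    using fin finite_words[OF fin, of n] by (subst sum.Sigma) auto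
  also have "\<dots> = word_sum G w (Suc n) g"
    unfolding word_sum_def
  proof (rule sum.reindex_bij_witness[of _ "\<lambda>l. (hd l, tl l)" "\<lambda>(h, l). h # l"])
    fix l assume l: "l \<in> {l \<in> words G (Suc n). word_prod G l = g}"
    then obtain h t where "l = h # t" by (cases l) (auto simp: words_def)
    then show "(hd l, tl l) \<in> (SIGMA h:carrier G. {l \<in> words G n. word_prod G l = inv h \<otimes> g})"
      "(case (hd l, tl l) of (h, l) \<Rightarrow> h # l) = l"
      using l by (auto simp: words_def m_assoc[symmetric])
  next
    fix a assume "a \<in> (SIGMA h:carrier G. {l \<in> words G n. word_prod G l = inv h \<otimes> g})"
    then show "(case a of (h, l) \<Rightarrow> h # l) \<in> {l \<in> words G (Suc n). word_prod G l = g}"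
      "(hd (case a of (h, l) \<Rightarrow> h # l), tl (case a of (h, l) \<Rightarrow> h # l)) = a"
      "prod_list (map w (case a of (h, l) \<Rightarrow> h # l)) =
        (case a of (h, l) \<Rightarrow> w h * prod_list (map w l))"
      using g by (auto simp: words_def m_assoc[symmetric])
  qed
  finally show ?thesis by simp
qed

lemma sum_left_translate:
  assumes "h \<in> carrier G"
  shows "(\<Sum>g\<in>carrier G. f (inv h \<otimes> g)) = sum f (carrier G)"
  by (rule sum.reindex_bij_witness[of _ "\<lambda>g. h \<otimes> g" "\<lambda>g. inv h \<otimes> g"])
    (use assms in \<open>auto simp: m_assoc[symmetric]\<close>)

text \<open>The hypothesis says that \<open>w * w\<close> is \<open>\<delta> w\<close> plus
  \<open>\<mu>\<close> times the sum of all group elements. So \<open>w\<close> acts as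
  \<open>\<kappa>\<close> on the trivial part of the group ring and satisfies
  \<open>w * w = \<delta> w\<close> on the complement. The factor \<open>order G\<close> clears the
  denominator of this decomposition.\<close>

lemma word_sum_closed_form:
  fixes w :: "'a \<Rightarrow> int" and \<delta> \<mu> :: int
  assumes fin: "finite (carrier G)"
    and conv: "\<And>g. g \<in> carrier G \<Longrightarrow> (\<Sum>h\<in>carrier G. w h * w (inv h \<otimes> g)) = \<delta> * w g + \<mu>"
    and g: "g \<in> carrier G"
  defines "\<kappa> \<equiv> sum w (carrier G)"
  shows "order G * word_sum G w (Suc n) g = \<delta> ^ n * (order G * w g - \<kappa>) + \<kappa> ^ Suc n"
  using g
proof (induction n arbitrary: g)
  case 0
  have "word_sum G w (Suc 0) g = (\<Sum>h\<in>carrier G. if h = g then w h else 0)"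
    unfolding word_sum_Suc[OF fin 0] word_sum_0
  proof (intro sum.cong refl)
    fix h assume h: "h \<in> carrier G"
    have "inv h \<otimes> g = \<one> \<longleftrightarrow> h = g"
      using h 0 by (metis inv_equality inv_inv inv_closed l_inv)
    then show "w h * (if inv h \<otimes> g = \<one> then 1 else 0) = (if h = g then w h else 0)" by simp
  qed
  also have "\<dots> = w g" using fin 0 by simp
  finally show ?case by simp
next
  case (Suc n)
  \<comment> \<open>Taking augmentations in the quadratic relation yields a formula for
    \<open>order G * \<mu>\<close>, which removes \<open>\<mu>\<close> from the induction
    step.\<close>
  have "\<kappa> * \<kappa> = (\<Sum>h\<in>carrier G. w h * (\<Sum>g\<in>carrier G. w (inv h \<otimes> g)))"
    unfolding \<kappa>_def sum_distrib_right by (intro sum.cong refl) (simp add: sum_left_translate)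
  also have "\<dots> = (\<Sum>g\<in>carrier G. \<Sum>h\<in>carrier G. w h * w (inv h \<otimes> g))"
    unfolding sum_distrib_left by (rule sum.swap)
  also have "\<dots> = \<delta> * \<kappa> + order G * \<mu>"
    by (simp add: conv \<kappa>_def sum.distrib sum_distrib_left order_def)
  finally have kk: "\<kappa> * \<kappa> = \<delta> * \<kappa> + order G * \<mu>" .
  have "order G * word_sum G w (Suc (Suc n)) g =
      (\<Sum>h\<in>carrier G. w h * (order G * word_sum G w (Suc n) (inv h \<otimes> g)))"
    unfolding word_sum_Suc[OF fin Suc.prems, of w "Suc n"] by (simp add: sum_distrib_left mult_ac)
  also have "\<dots> = (\<Sum>h\<in>carrier G. \<delta> ^ n * order G * (w h * w (inv h \<otimes> g))
      + w h * (\<kappa> ^ Suc n - \<delta> ^ n * \<kappa>))"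
  proof (intro sum.cong refl)
    fix h assume "h \<in> carrier G"
    then have "inv h \<otimes> g \<in> carrier G" using Suc.prems by simp
    note IH = Suc.IH[OF this]
    show "w h * (order G * word_sum G w (Suc n) (inv h \<otimes> g)) =
      \<delta> ^ n * order G * (w h * w (inv h \<otimes> g)) + w h * (\<kappa> ^ Suc n - \<delta> ^ n * \<kappa>)"
      unfolding IH by (simp add: algebra_simps)
  qed
  also have "\<dots> = \<delta> ^ n * order G * (\<delta> * w g + \<mu>) + \<kappa> * (\<kappa> ^ Suc n - \<delta> ^ n * \<kappa>)"
    by (simp add: sum.distrib sum_distrib_left[symmetric] sum_distrib_right[symmetric]
        conv[OF Suc.prems] \<kappa>_def)
  also have "\<dots> = \<delta> ^ n * (\<delta> * order G * w g + order G * \<mu> - \<kappa> * \<kappa>) + \<kappa> ^ Suc (Suc n)"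
    by (simp add: algebra_simps)
  also have "\<dots> = \<delta> ^ Suc n * (order G * w g - \<kappa>) + \<kappa> ^ Suc (Suc n)"
    unfolding kk by (simp add: algebra_simps)
  finally show ?case .
qed

section \<open>p-adic divisibility of sums over p-singular classes\<close>

text \<open>Rotation acts on the words with product in \<open>C\<close> and preserves their weight.
  A word fixed by \<open>p ^ n\<close> rotations would have as its product a \<open>p ^ a\<close>-th
  power, with \<open>p ^ a\<close> the full power of \<open>p\<close> in the group order; such a
  product has order prime to \<open>p\<close>. So every orbit length is divisible by
  \<open>p ^ Suc n\<close>.\<close>

lemma dvd_class_word_sum:
  fixes w :: "'a \<Rightarrow> int" and p :: nat
  assumes fin: "finite (carrier G)" and p: "Factorial_Ring.prime p"
    and C: "C \<subseteq> carrier G" "\<And>x g. x \<in> C \<Longrightarrow> g \<in> carrier G \<Longrightarrow> g \<otimes> x \<otimes> inv g \<in> C"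
    and sing: "\<And>x. x \<in> C \<Longrightarrow> p dvd ord x"
  shows "int p ^ Suc n dvd (\<Sum>g\<in>C. word_sum G w (p ^ (n + multiplicity p (order G))) g)"
proof -
  define a where "a = multiplicity p (order G)"
  define N where "N = p ^ (n + a)"
  define L where "L = {l \<in> words G N. word_prod G l \<in> C}"
  define f where "f l = prod_list (map w l)" for l
  have finC: "finite C" and finL: "finite L"
    using fin C finite_words[OF fin] by (auto simp: L_def intro: finite_subset)
  have rot: "rotate1 l \<in> L" if "l \<in> L" for l
  proof -
    from that have l: "set l \<subseteq> carrier G" "length l = N" "word_prod G l \<in> C"
      by (auto simp: L_def words_def)
    obtain x where "x \<in> carrier G" "word_prod G (rotate1 l) = x \<otimes> word_prod G l \<otimes> inv x"
      using word_prod_rotate1[OF l(1)] by blast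
    then show ?thesis using l C(2)[OF l(3)] by (auto simp: L_def words_def)
  qed
  \<comment> \<open>The order of a \<open>p ^ a\<close>-th power divides the part \<open>m\<close>
    of the group order that is prime to \<open>p\<close>.\<close>
  have no_power: "x [^] (p ^ a) \<notin> C" if x: "x \<in> carrier G" for x
  proof
    assume "x [^] (p ^ a) \<in> C"
    then have dvd: "p dvd ord (x [^] (p ^ a))" by (rule sing)
    have pos: "order G \<noteq> 0" using fin order_gt_0_iff_finite by simp
    obtain m where m: "order G = p ^ a * m" "\<not> p dvd m"
      using multiplicity_decompose'[OF pos, of p] p unfolding a_def
      by (metis mult.commute not_prime_unit)
    have "(x [^] (p ^ a)) [^] m = \<one>"
      using x by (simp add: nat_pow_pow m(1)[symmetric] pow_order_eq_1)
    then have "ord (x [^] (p ^ a)) dvd m" using x by (simp add: pow_eq_id)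
    then show False using dvd m(2) dvd_trans by blast
  qed
  have "(\<Sum>g\<in>C. word_sum G w N g) = sum f L"
  proof -
    have "(\<Sum>g\<in>C. word_sum G w N g) =
      (\<Sum>g\<in>C. sum f {l. l \<in> L \<and> word_prod G l = g})"
      unfolding word_sum_def f_def by (intro sum.cong refl arg_cong2[where f = sum]) (auto simp: L_def)
    also have "\<dots> = sum f L" by (rule sum.group[OF finL finC]) (auto simp: L_def)
    finally show ?thesis .
  qed
  \<comment> \<open>Words are collected by weight: each fibre of \<open>f\<close> is closed under
    rotation, so the orbit count applies to its cardinality.\<close>
  also have "\<dots> = (\<Sum>c\<in>f ` L. sum f {l. l \<in> L \<and> f l = c})"
    using finL by (intro sum.group[symmetric]) auto
  also have "\<dots> = (\<Sum>c\<in>f ` L. c * card {l. l \<in> L \<and> f l = c})"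
    by (intro sum.cong refl) (simp add: mult.commute)
  also have "int p ^ Suc n dvd \<dots>"
  proof (intro dvd_sum dvd_mult)
    fix c
    have "p ^ Suc n dvd card {l. l \<in> L \<and> f l = c}"
    proof (rule dvd_card_if_least_period[OF p, where f = rotate1 and n = "n + a"])
      show "finite {l. l \<in> L \<and> f l = c}" using finL by simp
      fix l assume l: "l \<in> {l. l \<in> L \<and> f l = c}"
      have "f (rotate1 l) = f l"
        by (cases l) (auto simp: f_def mult.commute)
      then show "rotate1 l \<in> {l. l \<in> L \<and> f l = c}" using l rot by auto
      have len: "set l \<subseteq> carrier G" "length l = p ^ n * p ^ a"
        using l by (auto simp: L_def words_def N_def power_add)
      then show "(rotate1 ^^ p ^ (n + a)) l = l"
        unfolding rotate_def[symmetric] by (simp add: power_add)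
      show "(rotate1 ^^ p ^ n) l \<noteq> l"
        using word_prod_periodic[OF len] no_power l
        unfolding rotate_def[symmetric] by (auto simp: L_def)
    qed
    then show "int p ^ Suc n dvd int (card {l. l \<in> L \<and> f l = c})"
      by (metis of_nat_dvd_iff of_nat_power)
  qed
  finally show ?thesis unfolding N_def a_def .
qed

text \<open>The closed form, summed over \<open>C\<close>, expresses \<open>\<delta> ^ M * z\<close>
  through a class sum of coefficients and a high power of \<open>\<kappa>\<close>, both highly
  divisible by \<open>p\<close>. As \<open>\<delta>\<close> is prime to \<open>p\<close>, every
  power of \<open>p\<close> divides the fixed integer \<open>z\<close>, which must therefore
  vanish.\<close>

lemma class_sum_p_singular:
  fixes w :: "'a \<Rightarrow> int" and \<delta> \<mu> :: int and p :: nat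
  assumes fin: "finite (carrier G)" and p: "Factorial_Ring.prime p"
    and conv: "\<And>g. g \<in> carrier G \<Longrightarrow> (\<Sum>h\<in>carrier G. w h * w (inv h \<otimes> g)) = \<delta> * w g + \<mu>"
    and p\<kappa>: "int p dvd sum w (carrier G)" and p\<delta>: "\<not> int p dvd \<delta>"
    and C: "C \<subseteq> carrier G" "\<And>x g. x \<in> C \<Longrightarrow> g \<in> carrier G \<Longrightarrow> g \<otimes> x \<otimes> inv g \<in> C"
    and sing: "\<And>x. x \<in> C \<Longrightarrow> p dvd ord x"
  shows "order G * sum w C = card C * sum w (carrier G)"
proof (rule ccontr)
  define \<kappa> where "\<kappa> = sum w (carrier G)"
  define z where "z = order G * sum w C - card C * \<kappa>"
  assume "\<not> ?thesis"
  then have z: "z \<noteq> 0" by (simp add: z_def \<kappa>_def)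
  have p2: "p \<ge> 2" using p by (rule prime_ge_2_nat)
  have "int p ^ n dvd z" for n
  proof -
    define N where "N = p ^ (n + multiplicity p (order G))"
    have "n < p ^ n" using p2 by (simp add: power_gt_expt)
    also have "p ^ n \<le> N" unfolding N_def using p2 by (intro power_increasing) auto
    finally have Nn: "n < N" .
    then obtain M where M: "N = Suc M" using gr0_implies_Suc by fastforce
    have "order G * (\<Sum>g\<in>C. word_sum G w N g) = (\<Sum>g\<in>C. \<delta> ^ M * (order G * w g - \<kappa>) + \<kappa> ^ N)"
      unfolding sum_distrib_left \<kappa>_def M
      by (intro sum.cong refl word_sum_closed_form[OF fin conv]) (use C in auto)
    also have "\<dots> = \<delta> ^ M * z + card C * \<kappa> ^ N"
      by (simp add: sum.distrib sum_distrib_left[symmetric] sum_subtractf z_def)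
    finally have eq: "\<delta> ^ M * z = order G * (\<Sum>g\<in>C. word_sum G w N g) - card C * \<kappa> ^ N"
      by simp
    have "int p ^ n dvd (\<Sum>g\<in>C. word_sum G w N g)"
      using dvd_class_word_sum[OF fin p C sing, of n w] unfolding N_def
      by (rule power_le_dvd) auto
    moreover have "int p ^ n dvd \<kappa> ^ N"
      using p\<kappa> Nn dvd_power_same[of "int p" \<kappa> N] unfolding \<kappa>_def by (meson less_imp_le power_le_dvd)
    ultimately have "int p ^ n dvd \<delta> ^ M * z" unfolding eq by simp
    moreover have "coprime (int p ^ n) (\<delta> ^ M)"
      using p p\<delta> by (simp add: prime_imp_coprime)
    ultimately show ?thesis by (simp add: coprime_dvd_mult_right_iff)
  qed
  \<comment> \<open>The exponent \<open>\<bar>z\<bar>\<close> already suffices, because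
    \<open>p ^ m\<close> exceeds \<open>m\<close>.\<close>
  then have "int p ^ (nat \<bar>z\<bar>) dvd z" by blast
  then have "int p ^ (nat \<bar>z\<bar>) \<le> \<bar>z\<bar>" using z by (simp add: zdvd_imp_le)
  moreover have "\<bar>z\<bar> < int p ^ (nat \<bar>z\<bar>)"
  proof -
    have "nat \<bar>z\<bar> < p ^ nat \<bar>z\<bar>" using p2 by (simp add: power_gt_expt)
    then have "int (nat \<bar>z\<bar>) < int (p ^ nat \<bar>z\<bar>)" by (simp only: of_nat_less_iff)
    then show ?thesis by simp
  qed
  ultimately show False by simp
qed

end

section \<open>Sylow subgroups acting on abelian factors\<close>

context group
begin

lemma pow_card_subgroup:
  assumes H: "subgroup H G" and x: "x \<in> H"
  shows "x [^] card H = \<one>"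
proof -
  interpret H: group "G\<lparr>carrier := H\<rparr>" using H by (rule subgroup_imp_group)
  have "x [^]\<^bsub>G\<lparr>carrier := H\<rparr>\<^esub> card H = \<one>"
    using H.pow_order_eq_1[of x] x by (simp add: order_def)
  then show ?thesis by (simp add: nat_pow_consistent[symmetric])
qed

lemma conj_pow:
  assumes "c \<in> carrier G" "x \<in> carrier G"
  shows "(c \<otimes> x \<otimes> inv c) [^] (n::nat) = c \<otimes> x [^] n \<otimes> inv c"
proof (induction n)
  case (Suc n)
  have "inv c \<otimes> (c \<otimes> z) = z" if "z \<in> carrier G" for z
    using that assms by (simp add: m_assoc[symmetric])
  then show ?case using Suc assms by (simp add: m_assoc)
qed (use assms in simp)

lemma card_subgroup_dvd:
  assumes "subgroup H G" "subgroup K G" "H \<subseteq> K"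
  shows "card H dvd card K"
proof -
  interpret K: group "G\<lparr>carrier := K\<rparr>" using assms(2) by (rule subgroup_imp_group)
  have "subgroup H (G\<lparr>carrier := K\<rparr>)" using assms by (simp add: subgroup_incl)
  from K.lagrange[OF this] show ?thesis by (simp add: order_def) (metis dvd_triv_right)
qed

text \<open>Cauchy's theorem inside \<open>H\<close>, from Sylow's theorem with exponent 1.\<close>

lemma exists_element_of_prime_order:
  assumes fin: "finite (carrier G)" and H: "subgroup H G"
    and q: "Factorial_Ring.prime q" "q dvd card H"
  shows "\<exists>y\<in>H. y \<noteq> \<one> \<and> y [^] q = \<one>"
proof -
  interpret H: group "G\<lparr>carrier := H\<rparr>" using H by (rule subgroup_imp_group)
  have finH: "finite H" using fin subgroup.subset[OF H] finite_subset by blast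
  from q(2) obtain m where "card H = q ^ 1 * m" by auto
  then obtain K where K: "subgroup K (G\<lparr>carrier := H\<rparr>)" "card K = q ^ 1"
    using sylow_thm[OF q(1) H.is_group, of 1 m] finH by (auto simp: order_def)
  have "\<not> K \<subseteq> {\<one>}"
  proof
    assume "K \<subseteq> {\<one>}"
    then have "card K \<le> 1" using card_mono[of "{\<one>}" K] by simp
    then show False using K(2) prime_gt_1_nat[OF q(1)] by simp
  qed
  then obtain x where x: "x \<in> K" "x \<noteq> \<one>" by auto
  have "subgroup K G" using K(1) H incl_subgroup by blast
  then have "x [^] q = \<one>" using pow_card_subgroup[of K x] x K(2) by simp
  then show ?thesis using x subgroup.subset[OF K(1)] by auto
qed

text \<open>By orbit-stabilizer, the orbit of a point that is not fixed has size a power of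
  \<open>p\<close> other than 1, so \<open>p\<close> divides the number of such points.\<close>

lemma card_fixed_points_cong:
  assumes H: "subgroup H G" "card H = p ^ a" "finite H" and p: "Factorial_Ring.prime (p::nat)"
    and fin: "finite E"
    and closed: "\<And>h x. h \<in> H \<Longrightarrow> x \<in> E \<Longrightarrow> act h x \<in> E"
    and one: "\<And>x. x \<in> E \<Longrightarrow> act \<one> x = x"
    and mult: "\<And>g h x. g \<in> H \<Longrightarrow> h \<in> H \<Longrightarrow> x \<in> E \<Longrightarrow> act (g \<otimes> h) x = act g (act h x)"
  shows "card E mod p = card {x \<in> E. \<forall>h\<in>H. act h x = x} mod p"
proof -
  interpret H: subgroup H G by fact
  define F where "F = {x \<in> E. \<forall>h\<in>H. act h x = x}"
  have inv_act: "act (inv h) (act h x) = x" if "h \<in> H" "x \<in> E" for h x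
    using mult[of "inv h" h x] one that by simp
  have actF: "act h x \<in> E - F" if h: "h \<in> H" and x: "x \<in> E - F" for h x
  proof -
    have "act h x \<notin> F"
    proof
      assume "act h x \<in> F"
      then have "act (inv h) (act h x) = act h x" using h by (simp add: F_def)
      then have "act h x = x" using inv_act h x by simp
      then show False using \<open>act h x \<in> F\<close> x by simp
    qed
    then show ?thesis using closed h x by simp
  qed
  define r where "r = {(x, y). x \<in> E - F \<and> y \<in> E - F \<and> (\<exists>h\<in>H. act h x = y)}"
  have eq: "equiv (E - F) r"
  proof (rule equivI)
    show "r \<subseteq> (E - F) \<times> (E - F)" by (auto simp: r_def)
    show "refl_on (E - F) r" by (auto simp: refl_on_def r_def intro!: bexI[of _ "\<one>"] one)
    show "sym r"
    proof (rule symI)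
      fix x y assume "(x, y) \<in> r"
      then obtain h where "h \<in> H" "act h x = y" "x \<in> E - F" "y \<in> E - F" by (auto simp: r_def)
      then show "(y, x) \<in> r" using inv_act[of h x] by (auto simp: r_def intro!: bexI[of _ "inv h"])
    qed
    show "trans r"
    proof (rule transI)
      fix x y z assume "(x, y) \<in> r" "(y, z) \<in> r"
      then obtain h h' where "x \<in> E - F" "z \<in> E - F" "h \<in> H" "h' \<in> H" "act h' (act h x) = z"
        by (auto simp: r_def)
      then show "(x, z) \<in> r"
        by (auto simp: r_def mult intro!: bexI[of _ "h' \<otimes> h"])
    qed
  qed
  have "p dvd card B" if B: "B \<in> (E - F) // r" for B
  proof -
    from B obtain x where x: "x \<in> E - F" "B = r `` {x}" by (auto elim: quotientE)
    have Bim: "B = (\<lambda>h. act h x) ` H" using x actF by (auto simp: r_def)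
    define S where "S = {h \<in> H. act h x = x}"
    \<comment> \<open>The elements carrying \<open>x\<close> to \<open>y = act k x\<close> form the
      left coset of the stabilizer \<open>S\<close> by \<open>k\<close>. Summing over the orbit
      gives \<open>card B * card S = card H\<close>.\<close>
    have "card {h \<in> H. act h x = y} = card S" if "y \<in> B" for y
    proof -
      from that obtain k where k: "k \<in> H" "y = act k x" unfolding Bim by auto
      have "bij_betw (\<lambda>s. k \<otimes> s) S {h \<in> H. act h x = y}"
      proof (rule bij_betw_byWitness[where f' = "\<lambda>h. inv k \<otimes> h"])
        show "\<forall>s\<in>S. inv k \<otimes> (k \<otimes> s) = s" "\<forall>h\<in>{h \<in> H. act h x = y}. k \<otimes> (inv k \<otimes> h) = h"
          using k by (auto simp: S_def m_assoc[symmetric])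
        show "(\<lambda>s. k \<otimes> s) ` S \<subseteq> {h \<in> H. act h x = y}"
          using k x by (auto simp: S_def mult)
        show "(\<lambda>h. inv k \<otimes> h) ` {h \<in> H. act h x = y} \<subseteq> S"
          using k x by (auto simp: S_def mult inv_act)
      qed
      then show ?thesis by (simp add: bij_betw_same_card)
    qed
    moreover have "card H = (\<Sum>y\<in>B. card {h \<in> H. act h x = y})"
      unfolding Bim card_eq_sum by (rule sum.image_gen[OF H(3)])
    ultimately have "card B * card S = p ^ a" using H(2) by simp
    moreover have "card S \<noteq> card H"
    proof
      assume "card S = card H"
      then have "S = H" using H(3) by (intro card_subset_eq) (auto simp: S_def)
      then show False using x by (auto simp: S_def F_def)
    qed
    ultimately have "card B \<noteq> 1" using H(2) by auto
    moreover have "card B dvd p ^ a" using \<open>card B * card S = p ^ a\<close> by (metis dvd_triv_left)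
    then obtain i where "card B = p ^ i" using p divides_primepow_nat by blast
    ultimately show ?thesis by (cases i) auto
  qed
  then have "p dvd card (E - F)" using fin by (intro equiv_imp_dvd_card[OF _ eq]) auto
  moreover have "card E = card F + card (E - F)"
    using fin card_Un_disjoint[of F "E - F"] by (simp add: F_def Un_absorb1 finite_subset)
  ultimately show ?thesis unfolding F_def[symmetric]
    by (metis add.right_neutral dvd_imp_mod_0 mod_add_right_eq)
qed

section \<open>Normalizers and a Frattini argument\<close>

lemma normalizer_iff:
  assumes P: "subgroup P G" "finite P"
  shows "g \<in> normalizer G P \<longleftrightarrow> g \<in> carrier G \<and> (\<forall>h\<in>P. g \<otimes> h \<otimes> inv g \<in> P)"
proof (cases "g \<in> carrier G")
  case True
  interpret P: subgroup P G by fact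
  have im: "g <# P #> inv g = (\<lambda>h. g \<otimes> h \<otimes> inv g) ` P"
    by (auto simp: l_coset_def r_coset_def)
  have "inj_on (\<lambda>h. g \<otimes> h \<otimes> inv g) P"
    using True by (auto simp: inj_on_def)
  then have "card ((\<lambda>h. g \<otimes> h \<otimes> inv g) ` P) = card P" by (rule card_image)
  then have "(\<lambda>h. g \<otimes> h \<otimes> inv g) ` P = P \<longleftrightarrow> (\<lambda>h. g \<otimes> h \<otimes> inv g) ` P \<subseteq> P"
    using P(2) by (metis card_subset_eq order_refl)
  moreover have "g \<in> normalizer G P \<longleftrightarrow> g <# P #> inv g = P"
    using True P.subset by (simp add: normalizer_def stabilizer_def)
  ultimately show ?thesis using True unfolding im by auto
qed (auto simp: normalizer_def stabilizer_def)

text \<open>The conjugate of \<open>P\<close> by \<open>z\<close> permutes the cosets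
  \<open>l <# P\<close> with \<open>l\<close> in \<open>L\<close>, because it agrees with
  \<open>P\<close> modulo \<open>L\<close>. Their number is prime to \<open>p\<close>, so some
  \<open>l <# P\<close> is fixed. Then the conjugates of \<open>P\<close> by \<open>z\<close> and by
  \<open>l\<close> coincide, and \<open>inv l \<otimes> z\<close> normalizes
  \<open>P\<close>.\<close>

lemma sylow_frattini:
  assumes fin: "finite (carrier G)" and p: "Factorial_Ring.prime p" and P: "sylow_subgroup G p P"
    and L: "L \<lhd> G" and z: "z \<in> carrier G" "\<And>h. h \<in> P \<Longrightarrow> z \<otimes> h \<otimes> inv z \<otimes> inv h \<in> L"
  shows "\<exists>l\<in>L. inv l \<otimes> z \<in> normalizer G P"
proof -
  have subP: "subgroup P G" and cardP: "card P = p ^ multiplicity p (order G)"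
    using P by (auto simp: sylow_subgroup_def)
  interpret P: subgroup P G by (rule subP)
  interpret L: normal L G by (rule L)
  have finP: "finite P" using fin P.subset finite_subset by blast
  have finL: "finite L" using fin L.subset finite_subset by blast
  define E where "E = (\<lambda>l. l <# P) ` L"
  have mem: "x <# P = y <# P \<longleftrightarrow> inv x \<otimes> y \<in> P" if "x \<in> carrier G" "y \<in> carrier G" for x y
  proof
    assume "x <# P = y <# P"
    then have "y \<in> x <# P" using that by (auto simp: l_coset_def intro!: bexI[of _ "\<one>"])
    then show "inv x \<otimes> y \<in> P" using that by (auto simp: l_coset_def m_assoc[symmetric])
  next
    assume "inv x \<otimes> y \<in> P"
    then have "y \<in> x <# P" using that
      by (auto simp: l_coset_def m_assoc[symmetric] intro!: bexI[of _ "inv x \<otimes> y"])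
    then show "x <# P = y <# P" using l_repr_independence that subP by blast
  qed
  have subE: "B \<subseteq> carrier G" if "B \<in> E" for B
    using that by (auto simp: E_def l_coset_def)
  have "card (x <# P) = card P" if "x \<in> carrier G" for x
  proof -
    have "x <# P = (\<lambda>h. x \<otimes> h) ` P" by (auto simp: l_coset_def)
    moreover have "inj_on (\<lambda>h. x \<otimes> h) P" using that by (auto simp: inj_on_def)
    ultimately show ?thesis by (simp add: card_image)
  qed
  moreover have "B \<inter> B' = {}" if BB: "B \<in> E" "B' \<in> E" "B \<noteq> B'" for B B'
  proof (rule ccontr)
    assume "B \<inter> B' \<noteq> {}"
    then obtain u where u: "u \<in> B" "u \<in> B'" by auto
    obtain l l' where "l \<in> L" "l' \<in> L" "B = l <# P" "B' = l' <# P"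
      using BB by (auto simp: E_def)
    then have "u <# P = B" "u <# P = B'"
      using u l_repr_independence[OF _ _ subP] L.mem_carrier by metis+
    then show False using BB by simp
  qed
  \<comment> \<open>The cosets partition the subgroup \<open>L <#> P\<close>, whose order divides
    that of \<open>G\<close>. Since \<open>P\<close> carries the full power of \<open>p\<close>,
    none is left for \<open>card E\<close>.\<close>
  ultimately have "card P * card E = card (\<Union>E)"
    using finL finite_subset[OF _ fin] subE
    by (intro card_partition) (auto simp: E_def)
  also have "\<Union>E = L <#> P" by (auto simp: E_def l_coset_def set_mult_def)
  also have "card (L <#> P) dvd order G"
  proof -
    interpret second_isomorphism_grp L G P
      by unfold_locales
    show ?thesis using lagrange[OF normal_set_mult_subgroup] by (metis dvd_triv_right)
  qed
  finally have dvd: "p ^ multiplicity p (order G) * card E dvd order G" unfolding cardP .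
  have ndvd: "\<not> p dvd card E"
  proof
    assume "p dvd card E"
    then have "p ^ multiplicity p (order G) * p dvd order G"
      using dvd by (meson dvd_refl dvd_trans mult_dvd_mono)
    then have "p ^ Suc (multiplicity p (order G)) dvd order G" by (simp add: mult.commute)
    moreover have "order G \<noteq> 0" using fin order_gt_0_iff_finite by simp
    ultimately show False
      using multiplicity_geI[of "order G" p "Suc (multiplicity p (order G))"] prime_gt_1_nat[OF p]
      by simp
  qed
  define c where "c h = z \<otimes> h \<otimes> inv z" for h
  have c: "c h \<in> carrier G" if "h \<in> P" for h using that z by (simp add: c_def)
  have c_mult: "c (g \<otimes> h) = c g \<otimes> c h" if "g \<in> P" "h \<in> P" for g h
    using that z by (simp add: c_def m_assoc) (simp add: m_assoc[symmetric])
  have "card E mod p = card {x \<in> E. \<forall>h\<in>P. c h <# x = x} mod p"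
  proof (rule card_fixed_points_cong[OF subP cardP finP p])
    show "finite E" using finL by (simp add: E_def)
    show "c \<one> <# x = x" if "x \<in> E" for x
      using subE[OF that] z by (simp add: c_def lcos_mult_one)
    show "c (g \<otimes> h) <# x = c g <# (c h <# x)" if "g \<in> P" "h \<in> P" "x \<in> E" for g h x
      using subE[OF that(3)] c that by (simp add: c_mult lcos_m_assoc)
    show "c h <# x \<in> E" if h: "h \<in> P" and x: "x \<in> E" for h x
    proof -
      from x obtain l where l: "l \<in> L" "x = l <# P" by (auto simp: E_def)
      \<comment> \<open>This is \<open>c h \<otimes> l \<otimes> inv h\<close>, written as a product
        of two elements of \<open>L\<close>: the commutator from the hypothesis and a conjugate of
        \<open>l\<close>.\<close>
      define l' where "l' = (c h \<otimes> inv h) \<otimes> (h \<otimes> l \<otimes> inv h)"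
      have l': "l' \<in> L" using z(2)[OF h] L.inv_op_closed2[of h l] l h by (auto simp: l'_def c_def)
      have "c h <# x = (c h \<otimes> l) <# P" using l c h P.subset by (simp add: lcos_m_assoc)
      also have "\<dots> = l' <# P"
      proof -
        have "l' \<otimes> h = c h \<otimes> l" using l h c[OF h]
          by (simp add: l'_def m_assoc) (simp add: m_assoc[symmetric])
        then have "inv l' \<otimes> (c h \<otimes> l) = h" using l' h l c[OF h] inv_solve_left[of h l' "c h \<otimes> l"]
          by simp
        then show ?thesis using mem[of l' "c h \<otimes> l"] l' l c[OF h] h by simp
      qed
      finally show ?thesis using l' by (simp add: E_def)
    qed
  qed
  then have "{x \<in> E. \<forall>h\<in>P. c h <# x = x} \<noteq> {}"
    using ndvd by (metis card.empty dvd_eq_mod_eq_0 mod_0)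
  then obtain l where l: "l \<in> L" "\<And>h. h \<in> P \<Longrightarrow> c h <# (l <# P) = l <# P"
    by (auto simp: E_def)
  have "inv l \<otimes> z \<otimes> h \<otimes> inv (inv l \<otimes> z) \<in> P" if h: "h \<in> P" for h
  proof -
    have "l <# P = (c h \<otimes> l) <# P" using l h c P.subset by (simp add: lcos_m_assoc[symmetric])
    then have "inv l \<otimes> (c h \<otimes> l) \<in> P" using mem l c[OF h] by simp
    then show ?thesis using h l z by (simp add: c_def inv_mult_group m_assoc)
  qed
  then show ?thesis using l z normalizer_iff[OF subP finP] by auto
qed

end

section \<open>Primary parts of abelian factors and the derived series\<close>

text \<open>Describes the Sylow \<open>q\<close>-subgroup of an abelian group by an equation, which
  makes its invariance under conjugation evident. By Cauchy, the order of the torsion subgroup is a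
  power of \<open>q\<close>. It divides the group order, and the subgroup contains a Sylow
  \<open>q\<close>-subgroup.\<close>

lemma (in comm_group) card_prime_power_torsion:
  assumes fin: "finite (carrier G)" and q: "Factorial_Ring.prime (q::nat)"
  defines "e \<equiv> multiplicity q (order G)"
  shows "card {a \<in> carrier G. a [^] (q ^ e) = \<one>} = q ^ e"
proof -
  define T where "T = {a \<in> carrier G. a [^] (q ^ e) = \<one>}"
  have finT: "finite T" using fin by (simp add: T_def)
  have pos: "order G \<noteq> 0" using fin order_gt_0_iff_finite by simp
  have sub: "subgroup T G"
    by (rule subgroupI) (auto simp: T_def nat_pow_inv nat_pow_distrib)
  have only_q: "r = q" if r: "Factorial_Ring.prime r" "r dvd card T" for r
  proof -
    obtain x where x: "x \<in> T" "x \<noteq> \<one>" "x [^] r = \<one>"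
      using exists_element_of_prime_order[OF fin sub r] by blast
    then have "x \<in> carrier G" "x [^] (q ^ e) = \<one>" by (auto simp: T_def)
    then have "ord x dvd r" "ord x dvd q ^ e" using x by (simp_all add: pow_eq_id)
    moreover have "ord x \<noteq> 1" using x ord_eq_1[OF \<open>x \<in> carrier G\<close>] by blast
    ultimately have "r dvd q ^ e" using r(1) by (metis prime_nat_iff)
    then show ?thesis using r(1) q prime_dvd_power primes_dvd_imp_eq by blast
  qed
  have "card T \<noteq> 0" using finT subgroup.one_closed[OF sub] by auto
  then obtain y where y: "card T = q ^ multiplicity q (card T) * y" "\<not> q dvd y"
    using multiplicity_decompose'[of "card T" q] q by (metis mult.commute not_prime_unit)
  have "y = 1"
  proof (rule ccontr)
    assume "y \<noteq> 1"
    then obtain r where r: "Factorial_Ring.prime r" "r dvd y" using prime_factor_nat by blast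
    then have "r dvd card T" using y(1) by (metis dvd_mult)
    then show False using only_q r y(2) by blast
  qed
  with y(1) have "card T = q ^ multiplicity q (card T)" by simp
  moreover have "card T dvd order G" using lagrange[OF sub] by (metis dvd_triv_right)
  then have "multiplicity q (card T) \<le> e"
    unfolding e_def by (rule dvd_imp_multiplicity_le[OF _ pos])
  moreover obtain m where "order G = q ^ e * m" unfolding e_def using multiplicity_dvd dvdE by metis
  then obtain K where K: "subgroup K G" "card K = q ^ e"
    using sylow_thm[OF q is_group _ fin] by blast
  have "K \<subseteq> T"
  proof
    fix x assume x: "x \<in> K"
    then show "x \<in> T" using K pow_card_subgroup[OF K(1) x] subgroup.subset[OF K(1)]
      by (auto simp: T_def)
  qed
  then have "q ^ e \<le> card T" using finT K(2) card_mono by metis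
  ultimately show ?thesis unfolding T_def[symmetric]
    using power_increasing[of "multiplicity q (card T)" e q] prime_ge_1_nat[OF q] by simp
qed

context group
begin

text \<open>\<open>P\<close> acts by conjugation on the Sylow \<open>q\<close>-subgroup
  \<open>T\<close> of the abelian group \<open>M / L\<close>. A fixed point lifts to the normalizer
  of \<open>P\<close>, whose order is prime to \<open>q\<close>, so only the identity is fixed and
  \<open>card T\<close> is 1 modulo \<open>p\<close>.\<close>

lemma abelian_factor_prime_part_cong:
  assumes fin: "finite (carrier G)"
    and p: "Factorial_Ring.prime p" and q: "Factorial_Ring.prime q"
    and P: "sylow_subgroup G p P" and nq: "\<not> q dvd card (normalizer G P)"
    and L: "L \<lhd> G" and M: "M \<lhd> G" and LM: "L \<subseteq> M"
    and comm: "\<And>x y. x \<in> M \<Longrightarrow> y \<in> M \<Longrightarrow> x \<otimes> y \<otimes> inv x \<otimes> inv y \<in> L"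
  shows "q ^ multiplicity q (card M) mod p = q ^ multiplicity q (card L) mod p"
proof -
  interpret L: normal L G by (rule L)
  interpret M: normal M G by (rule M)
  have subP: "subgroup P G" and cardP: "card P = p ^ multiplicity p (order G)"
    using P by (auto simp: sylow_subgroup_def)
  interpret P: subgroup P G by (rule subP)
  have finP: "finite P" using fin P.subset finite_subset by blast
  define Q where "Q = G Mod L"
  define f where "f x = L #> x" for x
  interpret Q: group Q unfolding Q_def by (rule L.factorgroup_is_group)
  interpret f: group_hom G Q f
    unfolding Q_def f_def
    using L.r_coset_hom_Mod L.factorgroup_is_group
    by (auto simp: group_hom_def group_hom_axioms_def is_group)
  have f_eq: "f x = f y \<longleftrightarrow> x \<otimes> inv y \<in> L" if "x \<in> carrier G" "y \<in> carrier G" for x y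
    using that L.rcos_module[OF is_group] unfolding f_def
    by (metis repr_independence rcos_self L.subgroup_axioms)
  have f_one: "f x = \<one>\<^bsub>Q\<^esub> \<longleftrightarrow> x \<in> L" if "x \<in> carrier G" for x
    using f_eq[OF that one_closed] that by simp
  have f_surj: "\<exists>x\<in>carrier G. a = f x" if "a \<in> carrier Q" for a
    using that by (auto simp: Q_def f_def carrier_FactGroup)
  define A where "A = f ` M"
  have subA: "subgroup A Q" unfolding A_def by (rule f.subgroup_img_is_subgroup) (rule M.subgroup_axioms)
  define A' where "A' = Q\<lparr>carrier := A\<rparr>"
  have finA: "finite A" using fin M.subset by (auto simp: A_def intro: finite_subset)
  have cA': "carrier A' = A" "order A' = card A" by (simp_all add: A'_def order_def)
  interpret A: subgroup A Q by (rule subA)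
  have commA: "comm_group A'"
  proof (rule group.group_comm_groupI)
    show "group A'" unfolding A'_def using subA by (rule Q.subgroup_imp_group)
    fix a b assume "a \<in> carrier A'" "b \<in> carrier A'"
    then obtain x y where xy: "x \<in> M" "y \<in> M" "a = f x" "b = f y"
      by (auto simp: A'_def A_def)
    have "(x \<otimes> y) \<otimes> inv (y \<otimes> x) \<in> L" using comm[OF xy(1,2)] xy by (simp add: inv_mult_group m_assoc)
    then have "f (x \<otimes> y) = f (y \<otimes> x)" using xy by (simp add: f_eq del: f.hom_mult)
    then show "a \<otimes>\<^bsub>A'\<^esub> b = b \<otimes>\<^bsub>A'\<^esub> a" using xy by (simp add: A'_def)
  qed
  interpret A': comm_group A' by (rule commA)
  have pow': "a [^]\<^bsub>A'\<^esub> (n::nat) = a [^]\<^bsub>Q\<^esub> n" for a n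
    by (simp add: A'_def Q.nat_pow_consistent[symmetric])
  define e where "e = multiplicity q (card A)"
  define T where "T = {a \<in> A. a [^]\<^bsub>Q\<^esub> (q ^ e) = \<one>\<^bsub>Q\<^esub>}"
  have cardT: "card T = q ^ e"
    using A'.card_prime_power_torsion[OF _ q] finA
    unfolding cA' pow' T_def e_def by (simp add: A'_def)
  have finT: "finite T" using finA by (simp add: T_def)
  have cardM: "card M = card A * card L"
  proof -
    interpret M': group "G\<lparr>carrier := M\<rparr>" by (rule subgroup_imp_group[OF M.subgroup_axioms])
    have "subgroup L (G\<lparr>carrier := M\<rparr>)"
      using L.subgroup_axioms M.subgroup_axioms LM by (simp add: subgroup_incl)
    moreover have "rcosets\<^bsub>G\<lparr>carrier := M\<rparr>\<^esub> L = A" by (auto simp: RCOSETS_def A_def f_def)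
    ultimately show ?thesis using M'.lagrange[of L] by (simp add: order_def)
  qed
  define act where "act h a = f h \<otimes>\<^bsub>Q\<^esub> a \<otimes>\<^bsub>Q\<^esub> inv\<^bsub>Q\<^esub> f h" for h a
  have "card T mod p = card {a \<in> T. \<forall>h\<in>P. act h a = a} mod p"
  proof (rule card_fixed_points_cong[OF subP cardP finP p finT])
    fix h a assume h: "h \<in> P" and a: "a \<in> T"
    then obtain x where x: "x \<in> M" "a = f x" by (auto simp: T_def A_def)
    have "act h a = f (h \<otimes> x \<otimes> inv h)" using x h by (simp add: act_def)
    then have "act h a \<in> A" using M.inv_op_closed2[of h x] h x unfolding A_def
      by (metis P.mem_carrier imageI)
    moreover have "act h a [^]\<^bsub>Q\<^esub> (q ^ e) = \<one>\<^bsub>Q\<^esub>"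
      using Q.conj_pow[of "f h" a] a h by (simp add: act_def T_def)
    ultimately show "act h a \<in> T" by (simp add: T_def)
  next
    fix a assume "a \<in> T"
    then show "act \<one> a = a" by (simp add: act_def T_def)
  next
    fix g h a assume "g \<in> P" "h \<in> P" "a \<in> T"
    then show "act (g \<otimes> h) a = act g (act h a)"
      by (simp add: act_def T_def Q.m_assoc Q.inv_mult_group)
  qed
  also have "{a \<in> T. \<forall>h\<in>P. act h a = a} = {\<one>\<^bsub>Q\<^esub>}"
  proof
    show "{\<one>\<^bsub>Q\<^esub>} \<subseteq> {a \<in> T. \<forall>h\<in>P. act h a = a}" by (auto simp: T_def act_def)
    show "{a \<in> T. \<forall>h\<in>P. act h a = a} \<subseteq> {\<one>\<^bsub>Q\<^esub>}"
    proof
      fix a assume a: "a \<in> {a \<in> T. \<forall>h\<in>P. act h a = a}"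
      then obtain z where z: "z \<in> M" "a = f z" by (auto simp: T_def A_def)
      \<comment> \<open>A fixed coset commutes with the image of \<open>P\<close> in the quotient,
        which is the commutator hypothesis of the Frattini argument.\<close>
      have "z \<otimes> h \<otimes> inv z \<otimes> inv h \<in> L" if h: "h \<in> P" for h
      proof -
        have "f (h \<otimes> z \<otimes> inv h) = f z" using a z h by (simp add: act_def)
        then have "f (h \<otimes> z \<otimes> inv h) \<otimes>\<^bsub>Q\<^esub> f h = f z \<otimes>\<^bsub>Q\<^esub> f h" by simp
        then have "f (z \<otimes> h) = f (h \<otimes> z)" using z h
          by (simp add: Q.m_assoc del: f.hom_mult flip: f.hom_mult) (simp add: m_assoc)
        then show ?thesis using z h by (simp add: f_eq inv_mult_group m_assoc del: f.hom_mult)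
      qed
      then have "\<exists>l\<in>L. inv l \<otimes> z \<in> normalizer G P"
        by (intro sylow_frattini[OF fin p P L]) (use z in simp_all)
      then obtain l where l: "l \<in> L" "inv l \<otimes> z \<in> normalizer G P" by blast
      \<comment> \<open>Another representative of \<open>a\<close>, now in the normalizer. The order
        of \<open>a\<close> thus divides both the normalizer order and \<open>q ^ e\<close>, which
        are coprime.\<close>
      define n where "n = inv l \<otimes> z"
      have nG: "n \<in> carrier G" using l z by (simp add: n_def)
      have fn: "f n = a"
        using l z f_one[of "inv l"] by (simp add: n_def)
      have subN: "subgroup (normalizer G P) G" by (rule normalizer_imp_subgroup[OF P.subset])
      have "n [^] card (normalizer G P) = \<one>"
        using pow_card_subgroup[OF subN] l(2) by (simp add: n_def)
      then have "a [^]\<^bsub>Q\<^esub> card (normalizer G P) = \<one>\<^bsub>Q\<^esub>"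
        using f.hom_nat_pow[OF nG, of "card (normalizer G P)"] fn by simp
      moreover have aQ: "a \<in> carrier Q" using z by simp
      ultimately have "Q.ord a dvd card (normalizer G P)" by (simp add: Q.pow_eq_id)
      moreover have "Q.ord a dvd q ^ e" using a aQ by (simp add: T_def Q.pow_eq_id)
      moreover have "coprime (card (normalizer G P)) (q ^ e)"
        using q nq by (simp add: prime_imp_coprime coprime_commute)
      ultimately have "Q.ord a = 1"
        by (metis coprime_common_divisor_nat)
      then show "a \<in> {\<one>\<^bsub>Q\<^esub>}" using Q.ord_eq_1[OF aQ] by blast
    qed
  qed
  finally have T1: "q ^ e mod p = 1 mod p" unfolding cardT by simp
  have "card A \<noteq> 0" "card L \<noteq> 0"
    using finA A.one_closed L.one_closed finite_subset[OF L.subset fin]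
    by (metis card_0_eq empty_iff)+
  then have "multiplicity q (card M) = e + multiplicity q (card L)"
    unfolding cardM e_def using q by (simp add: prime_elem_multiplicity_mult_distrib)
  then have "q ^ multiplicity q (card M) mod p = (q ^ e mod p) * q ^ multiplicity q (card L) mod p"
    by (simp add: power_add mod_mult_left_eq)
  then show ?thesis unfolding T1 by (simp add: mod_mult_left_eq)
qed

text \<open>Successive terms of the derived series have abelian quotients, so the residue of the
  \<open>q\<close>-part of their orders is constant down to the trivial group.\<close>

lemma solvable_prime_part_cong_1:
  assumes fin: "finite (carrier G)" and sol: "solvable G"
    and p: "Factorial_Ring.prime p" and q: "Factorial_Ring.prime q"
    and P: "sylow_subgroup G p P" and nq: "\<not> q dvd card (normalizer G P)"
  shows "q ^ multiplicity q (order G) mod p = 1 mod p"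
proof -
  let ?D = "\<lambda>i. (derived G ^^ i) (carrier G)"
  have norm: "?D i \<lhd> G" for i
    by (induction i) (auto simp: normal_self derived_is_normal)
  have "q ^ multiplicity q (card (?D i)) mod p = q ^ multiplicity q (order G) mod p" for i
  proof (induction i)
    case 0 then show ?case by (simp add: order_def)
  next
    case (Suc i)
    have sub: "subgroup (?D i) G" by (rule normal_imp_subgroup[OF norm])
    have "q ^ multiplicity q (card (?D i)) mod p = q ^ multiplicity q (card (?D (Suc i))) mod p"
    proof (rule abelian_factor_prime_part_cong[OF fin p q P nq norm norm])
      show "?D (Suc i) \<subseteq> ?D i" using derived_incl[OF _ sub] by simp
      fix x y assume "x \<in> ?D i" "y \<in> ?D i"
      then show "x \<otimes> y \<otimes> inv x \<otimes> inv y \<in> ?D (Suc i)"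
        unfolding funpow.simps comp_apply derived_def by (intro generate.incl) auto
    qed
    then show ?case using Suc by simp
  qed
  moreover obtain n where "?D n = {\<one>}" using sol solvable_iff_trivial_derived_seq by blast
  ultimately show ?thesis by (metis card.empty card.insert empty_iff finite.emptyI multiplicity_one One_nat_def power_0)
qed

text \<open>Conjugation by \<open>y\<close> permutes the elements of \<open>P\<close> in a
  nontrivial coset of \<open>K\<close>, and their number is a power of \<open>p\<close>. Without a
  fixed point all its orbits would have length \<open>q\<close>, and \<open>q\<close> would divide
  that power.\<close>

lemma commuting_element_outside_normal:
  assumes fin: "finite (carrier G)" and p: "Factorial_Ring.prime p" and q: "Factorial_Ring.prime q"
    and pq: "p \<noteq> q" and P: "subgroup P G" "card P = p ^ a"
    and K: "K \<lhd> G" "\<not> P \<subseteq> K"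
    and y: "y \<in> normalizer G P" "y [^] q = \<one>"
    and comm: "\<And>x. x \<in> P \<Longrightarrow> y \<otimes> x \<otimes> inv y \<otimes> inv x \<in> K"
  shows "\<exists>x\<in>P. x \<noteq> \<one> \<and> y \<otimes> x = x \<otimes> y"
proof (rule ccontr)
  assume none: "\<not> ?thesis"
  interpret P: subgroup P G by (rule P)
  interpret K: normal K G by (rule K)
  have finP: "finite P" using fin P.subset finite_subset by blast
  have yG: "y \<in> carrier G" and yP: "\<And>h. h \<in> P \<Longrightarrow> y \<otimes> h \<otimes> inv y \<in> P"
    using y normalizer_iff[OF P(1) finP] by auto
  obtain c where c: "c \<in> P" "c \<notin> K" using K by auto
  define E where "E = {x \<in> P. x \<otimes> inv c \<in> K}"
  define f where "f x = y \<otimes> x \<otimes> inv y" for x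
  have "bij_betw (\<lambda>k. k \<otimes> c) (P \<inter> K) E"
    by (rule bij_betw_byWitness[where f' = "\<lambda>x. x \<otimes> inv c"]) (use c in \<open>auto simp: E_def m_assoc\<close>)
  then have "card E = card (P \<inter> K)" by (simp add: bij_betw_same_card)
  moreover have "card (P \<inter> K) dvd card P"
    using subgroups_Inter_pair[OF P(1) K.subgroup_axioms] P(1) by (intro card_subgroup_dvd) auto
  ultimately have "card E dvd p ^ a" using P(2) by simp
  moreover have "q ^ Suc 0 dvd card E"
  proof (rule dvd_card_if_least_period[OF q, where f = f and n = 1])
    show "finite E" using finP by (simp add: E_def)
    fix x assume x: "x \<in> E"
    then have xP: "x \<in> P" and xc: "x \<otimes> inv c \<in> K" by (auto simp: E_def)
    have "(y \<otimes> x \<otimes> inv y \<otimes> inv x) \<otimes> (x \<otimes> inv c) \<in> K" using comm[OF xP] xc by simp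
    then have "f x \<otimes> inv c \<in> K" using xP c yG
      by (simp add: f_def m_assoc) (simp add: m_assoc[symmetric])
    then show "f x \<in> E" using yP xP by (simp add: E_def f_def)
    have it: "(f ^^ i) x = y [^] i \<otimes> x \<otimes> inv (y [^] i)" for i
    proof (induction i)
      case (Suc i)
      have "y [^] Suc i = y \<otimes> y [^] i" using yG by (rule nat_pow_Suc2)
      then show ?case using Suc yG xP by (simp add: f_def inv_mult_group m_assoc del: nat_pow_Suc)
    qed (use xP in simp)
    show "(f ^^ (q ^ 1)) x = x" using it[of q] y(2) xP by simp
    show "(f ^^ (q ^ 0)) x \<noteq> x"
    proof
      assume "(f ^^ (q ^ 0)) x = x"
      then have "y \<otimes> x \<otimes> inv y \<otimes> y = x \<otimes> y" by (simp add: f_def)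
      then have "y \<otimes> x = x \<otimes> y" using yG xP by (simp add: m_assoc)
      \<comment> \<open>The identity is excluded as a fixed point because \<open>c\<close> was
        chosen outside \<open>K\<close>.\<close>
      then have "x = \<one>" using none xP by blast
      then have "inv c \<in> K" using xc c by simp
      then show False using c K.m_inv_closed[of "inv c"] by simp
    qed
  qed
  ultimately have "q dvd p ^ a" using dvd_trans by simp
  then show False using pq p q prime_dvd_power primes_dvd_imp_eq by blast
qed

end

section \<open>Partial difference sets\<close>

text \<open>\<open>s\<close> and \<open>d\<close> have the same parity, so the halving in
  \<open>PDS_theta\<close> is exact; the discriminant formula then gives the quadratic
  equation.\<close>

lemma PDS_theta_root:
  fixes s :: int
  assumes "s ^ 2 = PDS_Delta k lam mu" and i: "i \<in> {1, 2}"
  defines "d \<equiv> int lam - int mu" and "t \<equiv> PDS_theta lam mu s i"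
  shows "2 * t = d + (if i = 1 then s else - s)" and "t ^ 2 = d * t + (int k - int mu)"
proof -
  have s2: "s ^ 2 = d ^ 2 + 4 * (int k - int mu)" using assms(1) by (simp add: PDS_Delta_def d_def)
  have "even (s ^ 2) \<longleftrightarrow> even (d ^ 2)" unfolding s2 by simp
  then have "even s \<longleftrightarrow> even d" by simp
  then have ev: "even (d + s)" "even (d - s)" by auto
  show 2: "2 * t = d + (if i = 1 then s else - s)"
    using ev by (auto simp: t_def PDS_theta_def d_def[symmetric])
  have "(2 * t - d) ^ 2 = s ^ 2" unfolding 2 by simp
  then have "4 * t ^ 2 = 4 * (d * t + (int k - int mu))"
    unfolding s2 by (simp add: power2_eq_square algebra_simps)
  then show "t ^ 2 = d * t + (int k - int mu)" by simp
qed

context group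
begin

text \<open>As \<open>D\<close> is closed under inverses, its square in the group ring has
  coefficient \<open>k\<close> at the identity, \<open>lam\<close> on \<open>D\<close> and
  \<open>mu\<close> elsewhere. The equation for \<open>t\<close> is exactly what makes the identity
  coefficients agree after the shift to \<open>D - t\<close>.\<close>

lemma regular_PDS_convolution:
  fixes t :: int
  assumes fin: "finite (carrier G)" and D: "is_regular_PDS G D v k lam mu"
    and t: "t ^ 2 = (int lam - int mu) * t + (int k - int mu)" and g: "g \<in> carrier G"
  defines "w \<equiv> \<lambda>h. of_bool (h \<in> D) - t * of_bool (h = \<one>)"
  shows "(\<Sum>h\<in>carrier G. w h * w (inv h \<otimes> g)) = (int lam - int mu - 2 * t) * w g + int mu"
proof -
  have DG: "D \<subseteq> carrier G" and card: "card D = k" and D1: "\<one> \<notin> D"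
    and Dinv: "(\<lambda>x. inv x) ` D = D"
    and diff: "\<And>g. g \<in> carrier G \<Longrightarrow> g \<noteq> \<one> \<Longrightarrow>
        card {(x, y). x \<in> D \<and> y \<in> D \<and> x \<otimes> inv y = g} = (if g \<in> D then lam else mu)"
    using D by (auto simp: is_regular_PDS_def is_PDS_def)
  have inv_mem: "inv x \<in> D" if "x \<in> D" for x using Dinv that by blast
  have inv1: "inv h \<otimes> g = \<one> \<longleftrightarrow> h = g" if "h \<in> carrier G" for h
    using that g by (metis inv_equality inv_inv inv_closed l_inv)
  define N where "N = card {h \<in> D. inv h \<otimes> g \<in> D}"
  have "(\<Sum>h\<in>carrier G. w h * w (inv h \<otimes> g)) =
      (\<Sum>h\<in>carrier G. of_bool (h \<in> D \<and> inv h \<otimes> g \<in> D)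
        - (if h = g then t * of_bool (g \<in> D) else 0)
        - (if h = \<one> then t * of_bool (g \<in> D) - t ^ 2 * of_bool (g = \<one>) else 0))"
    by (intro sum.cong refl) (use g D1 in \<open>auto simp: w_def inv1 power2_eq_square\<close>)
  also have "\<dots> = (\<Sum>h\<in>carrier G. of_bool (h \<in> D \<and> inv h \<otimes> g \<in> D)) - t * of_bool (g \<in> D)
      - (t * of_bool (g \<in> D) - t ^ 2 * of_bool (g = \<one>))"
    using fin g by (simp add: sum_subtractf)
  also have "(\<Sum>h\<in>carrier G. of_bool (h \<in> D \<and> inv h \<otimes> g \<in> D)) = int N"
  proof -
    have "{h \<in> D. inv h \<otimes> g \<in> D} = carrier G \<inter> {h. h \<in> D \<and> inv h \<otimes> g \<in> D}" using DG by auto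
    then show ?thesis unfolding N_def using fin by (simp add: of_bool_def sum.If_cases)
  qed
  also have "N = (if g = \<one> then k else if g \<in> D then lam else mu)"
  proof (cases "g = \<one>")
    case True
    have "{h \<in> D. inv h \<otimes> g \<in> D} = D" using True DG inv_mem by auto
    then show ?thesis using True card by (simp add: N_def)
  next
    case False
    \<comment> \<open>Inverting the second factor turns factorizations of \<open>g\<close> into
      products from \<open>D\<close> into the quotients counted by the PDS condition.\<close>
    have "bij_betw (\<lambda>h. (h, inv (inv h \<otimes> g))) {h \<in> D. inv h \<otimes> g \<in> D}
        {(x, y). x \<in> D \<and> y \<in> D \<and> x \<otimes> inv y = g}"
    proof (rule bij_betw_byWitness[where f' = fst])
      show "(\<lambda>h. (h, inv (inv h \<otimes> g))) ` {h \<in> D. inv h \<otimes> g \<in> D} \<subseteq>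
          {(x, y). x \<in> D \<and> y \<in> D \<and> x \<otimes> inv y = g}"
        using DG g inv_mem by (auto simp: m_assoc[symmetric] subsetD)
      show "fst ` {(x, y). x \<in> D \<and> y \<in> D \<and> x \<otimes> inv y = g} \<subseteq> {h \<in> D. inv h \<otimes> g \<in> D}"
        using DG inv_mem by (auto simp: m_assoc[symmetric] subsetD)
      show "\<forall>a'\<in>{(x, y). x \<in> D \<and> y \<in> D \<and> x \<otimes> inv y = g}.
          (fst a', inv (inv (fst a') \<otimes> g)) = a'"
        using DG by (auto simp: m_assoc[symmetric] subsetD)
    qed auto
    then have "N = card {(x, y). x \<in> D \<and> y \<in> D \<and> x \<otimes> inv y = g}"
      unfolding N_def by (rule bij_betw_same_card)
    then show ?thesis using diff[OF g False] False by simp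
  qed
  finally show ?thesis using t D1 by (auto simp: w_def algebra_simps power2_eq_square)
qed

text \<open>The class sum formula is applied to \<open>D - t\<close>, where \<open>\<delta>\<close>
  is \<open>s\<close> up to sign and the augmentation is \<open>k - t\<close>. The identity is not
  in \<open>C\<close>, so the shift by \<open>t\<close> does not affect the sum over
  \<open>C\<close>.\<close>

lemma regular_PDS_class_count:
  assumes fin: "finite (carrier G)" and D: "is_regular_PDS G D v k lam mu"
    and s: "s ^ 2 = PDS_Delta k lam mu" and i: "i \<in> {1, 2}" and p: "p \<in> PDS_Pi v k lam mu s i"
    and C: "C \<subseteq> carrier G" "\<And>x g. x \<in> C \<Longrightarrow> g \<in> carrier G \<Longrightarrow> g \<otimes> x \<otimes> inv g \<in> C"
    and sing: "\<And>x. x \<in> C \<Longrightarrow> p dvd ord x"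
  shows "int (order G) * int (card (D \<inter> C)) = int (card C) * (int k - PDS_theta lam mu s i)"
proof -
  define t where "t = PDS_theta lam mu s i"
  define w where "w = (\<lambda>h. of_bool (h \<in> D) - t * of_bool (h = \<one>))"
  have pp: "Factorial_Ring.prime p" and ps: "\<not> int p dvd s" and pk: "int p dvd int k - t"
    using p by (auto simp: PDS_Pi_def t_def)
  have DG: "D \<subseteq> carrier G" and card: "card D = k"
    using D by (auto simp: is_regular_PDS_def is_PDS_def)
  note root = PDS_theta_root[OF s i, folded t_def]
  have finC: "finite C" using fin C finite_subset by blast
  have C1: "\<one> \<notin> C"
  proof
    assume "\<one> \<in> C"
    then have "p dvd 1" using sing[of \<one>] by simp
    then show False using pp not_prime_unit by blast
  qed
  have sumD: "(\<Sum>h\<in>B. of_bool (h \<in> D)) = int (card (D \<inter> B))" if "finite B" for B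
    using that by (simp add: of_bool_def sum.If_cases Int_commute)
  have total: "sum w (carrier G) = int k - t"
    using fin DG card
    by (simp add: w_def sum_subtractf sumD Int_absorb1 Int_absorb2 sum_distrib_left[symmetric])
  have "sum w C = int (card (D \<inter> C)) - (\<Sum>h\<in>C. t * of_bool (h = \<one>))"
    using finC by (simp only: w_def sum_subtractf sumD)
  also have "(\<Sum>h\<in>C. t * of_bool (h = \<one>)) = 0"
    using C1 by (intro sum.neutral) auto
  finally have wC: "sum w C = int (card (D \<inter> C))" by simp
  have "\<not> int p dvd int lam - int mu - 2 * t"
    using root(1) ps by (auto split: if_splits)
  moreover have "(\<Sum>h\<in>carrier G. w h * w (inv h \<otimes> g)) = (int lam - int mu - 2 * t) * w g + int mu"
    if "g \<in> carrier G" for g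
    using regular_PDS_convolution[OF fin D root(2) that] by (simp only: w_def)
  ultimately have "order G * sum w C = card C * sum w (carrier G)"
    using pk total by (intro class_sum_p_singular[OF fin pp _ _ _ C sing]) auto
  then show ?thesis unfolding wC total t_def by simp
qed

text \<open>If \<open>x\<close> and \<open>y\<close> commuted, the order of
  \<open>y \<otimes> x\<close> would be divisible by both \<open>p\<close> and \<open>q\<close>. The
  class count for its conjugacy class would then hold with both eigenvalues, forcing them to be
  equal.\<close>

lemma regular_PDS_no_mixed_commuting:
  assumes fin: "finite (carrier G)" and D: "is_regular_PDS G D v k lam mu"
    and s: "s ^ 2 = PDS_Delta k lam mu" and \<alpha>: "\<alpha> \<in> {1, 2}"
    and p: "p \<in> PDS_Pi v k lam mu s \<alpha>" and q: "q \<in> PDS_Pi v k lam mu s (3 - \<alpha>)"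
    and pq: "p \<noteq> q"
    and x: "x \<in> carrier G" "x \<noteq> \<one>" "x [^] (p ^ a) = \<one>"
    and y: "y \<in> carrier G" "y \<noteq> \<one>" "y [^] q = \<one>"
  shows "y \<otimes> x \<noteq> x \<otimes> y"
proof
  assume comm: "y \<otimes> x = x \<otimes> y"
  have pp: "Factorial_Ring.prime p" and qp: "Factorial_Ring.prime q" and ps: "\<not> int p dvd s"
    using p q by (auto simp: PDS_Pi_def)
  define g where "g = y \<otimes> x"
  have g: "g \<in> carrier G" using x y by (simp add: g_def)
  have gpow: "g [^] n = y [^] n \<otimes> x [^] n" for n :: nat
    unfolding g_def using x y comm by (intro pow_mult_distrib) auto
  have "ord x dvd p ^ a" using x by (simp add: pow_eq_id)
  moreover have "ord x \<noteq> 1" using x ord_eq_1 by blast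
  ultimately have px: "p dvd ord x"
    using pp divides_primepow_nat[of p "ord x" a] by (metis One_nat_def dvd_power not_gr0 power_0)
  have "ord y dvd q" using y by (simp add: pow_eq_id)
  moreover have "ord y \<noteq> 1" using y ord_eq_1 by blast
  ultimately have qy: "ord y = q" using qp by (metis prime_nat_iff)
  have np: "\<not> p dvd q" using pp qp pq primes_dvd_imp_eq by blast
  have nq: "\<not> q dvd p ^ a" using pp qp pq prime_dvd_power primes_dvd_imp_eq by blast
  have pow0: "g [^] (ord g * m) = \<one>" for m using g by (simp add: pow_eq_id)
  \<comment> \<open>This exponent kills both \<open>g\<close> and \<open>y\<close>, hence
    \<open>x\<close>; as \<open>p\<close> divides \<open>ord x\<close> but not \<open>q\<close>, it
    divides \<open>ord g\<close>. The roles are exchanged for \<open>q\<close> below.\<close>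
  have "x [^] (ord g * q) = \<one>"
  proof -
    have "y [^] (ord g * q) = \<one>" using y qy by (simp add: pow_eq_id)
    then show ?thesis using pow0[of q] gpow[of "ord g * q"] x by simp
  qed
  then have "p dvd ord g * q" using x px by (metis dvd_trans pow_eq_id)
  then have pg: "p dvd ord g" using np pp by (simp add: prime_dvd_mult_iff)
  have "y [^] (ord g * p ^ a) = \<one>"
  proof -
    have "x [^] (ord g * p ^ a) = \<one>"
      using x by (metis dvd_triv_right dvd_trans pow_eq_id)
    then show ?thesis using pow0[of "p ^ a"] gpow[of "ord g * p ^ a"] y by simp
  qed
  then have "q dvd ord g * p ^ a" using y qy by (metis pow_eq_id)
  then have qg: "q dvd ord g" using nq qp by (simp add: prime_dvd_mult_iff)
  define C where "C = (\<lambda>u. u \<otimes> g \<otimes> inv u) ` carrier G"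
  have CG: "C \<subseteq> carrier G" using g by (auto simp: C_def)
  have Cconj: "u \<otimes> c \<otimes> inv u \<in> C" if "c \<in> C" "u \<in> carrier G" for c u
  proof -
    from that obtain u' where "u' \<in> carrier G" "c = u' \<otimes> g \<otimes> inv u'" by (auto simp: C_def)
    then show ?thesis using that g unfolding C_def
      by (intro image_eqI[of _ _ "u \<otimes> u'"]) (auto simp: inv_mult_group m_assoc)
  qed
  have ordC: "ord g dvd ord c" if "c \<in> C" for c
  proof -
    from that obtain u where u: "u \<in> carrier G" "c = u \<otimes> g \<otimes> inv u" by (auto simp: C_def)
    then have "c [^] n = u \<otimes> g [^] n \<otimes> inv u" for n :: nat
      using conj_pow g by simp
    moreover have "c \<in> carrier G" using u g by simp
    ultimately have "u \<otimes> g [^] ord c \<otimes> inv u = \<one>" by (metis pow_ord_eq_1)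
    then have "u \<otimes> g [^] ord c = u" using u g by (metis inv_equality inv_inv inv_closed m_closed nat_pow_closed)
    then have "g [^] ord c = \<one>" using u g by simp
    then show ?thesis using g by (simp add: pow_eq_id)
  qed
  have \<beta>: "3 - \<alpha> \<in> {1, 2}" using \<alpha> by auto
  have "card C * (int k - PDS_theta lam mu s \<alpha>) = card C * (int k - PDS_theta lam mu s (3 - \<alpha>))"
    using regular_PDS_class_count[OF fin D s \<alpha> p CG Cconj] ordC pg
      regular_PDS_class_count[OF fin D s \<beta> q CG Cconj] qg dvd_trans
    by metis
  moreover have "card C \<noteq> 0"
    using fin by (auto simp: C_def)
  ultimately have "PDS_theta lam mu s \<alpha> = PDS_theta lam mu s (3 - \<alpha>)" by simp
  \<comment> \<open>The two eigenvalues differ by \<open>s\<close> up to sign, and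
    \<open>s = 0\<close> would be divisible by \<open>p\<close>.\<close>
  then have "s = 0"
    using PDS_theta_root(1)[OF s \<alpha>] PDS_theta_root(1)[OF s \<beta>] \<alpha> by auto
  then show False using ps by simp
qed

end

section \<open>Coprimality with the normalizer order and the congruence modulo p\<close>

theorem mainTheorem11:
  fixes G :: "('a, 'b) monoid_scheme" and D :: "'a set"
    and v k lam mu :: nat and s :: int and p \<alpha> \<beta> :: nat and P :: "'a set"
  assumes "group G" and "finite (carrier G)"
    and "is_regular_PDS G D v k lam mu"
    and "0 < mu" and "mu < k"
    and "s \<ge> 0" and "s ^ 2 = PDS_Delta k lam mu"
    and "Factorial_Ring.prime p" and "p dvd order G" and "\<not> int p dvd s"
    and "\<alpha> \<in> {1, 2}" and "\<beta> = 3 - \<alpha>"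
    and "p \<in> PDS_Pi v k lam mu s \<alpha>"
    and "p dvd card (rcosets\<^bsub>G\<^esub> (derived G (carrier G)))"
    and "sylow_subgroup G p P"
  shows "coprime (card (normalizer G P)) (PDS_pi v k lam mu s \<beta>)
         \<and> (solvable G \<longrightarrow> PDS_pi v k lam mu s \<beta> mod p = 1 mod p)"
proof -
  interpret group G by fact
  note fin = assms(2) and p = assms(8)
  have ordG: "order G = v" using assms(3) by (simp add: is_regular_PDS_def is_PDS_def)
  have pos: "order G \<noteq> 0" using fin order_gt_0_iff_finite by simp
  have subP: "subgroup P G" and cardP: "card P = p ^ multiplicity p (order G)"
    using assms(15) by (auto simp: sylow_subgroup_def)
  interpret P: subgroup P G by (rule subP)
  have finP: "finite P" using fin P.subset finite_subset by blast
  have subN: "subgroup (normalizer G P) G" by (rule normalizer_imp_subgroup[OF P.subset])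
  define K where "K = derived G (carrier G)"
  have K: "K \<lhd> G" unfolding K_def by (rule derived_self_is_normal)
  interpret K: normal K G by (rule K)
  \<comment> \<open>If the derived subgroup contained \<open>P\<close>, its order would absorb the
    full power of \<open>p\<close>, and the index would contribute one more factor
    \<open>p\<close>.\<close>
  have PK: "\<not> P \<subseteq> K"
  proof
    assume "P \<subseteq> K"
    then have "card P dvd card K" using subP K.subgroup_axioms by (intro card_subgroup_dvd)
    then have "p ^ multiplicity p (order G) * p dvd card K * card (rcosets\<^bsub>G\<^esub> K)"
      using assms(14) unfolding cardP K_def by (rule mult_dvd_mono)
    also have "card K * card (rcosets\<^bsub>G\<^esub> K) = order G"
      using lagrange[OF K.subgroup_axioms] by (simp add: mult.commute)
    finally have "p ^ Suc (multiplicity p (order G)) dvd order G" by (simp add: mult.commute)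
    then show False
      using multiplicity_geI[of "order G" p "Suc (multiplicity p (order G))"] prime_gt_1_nat[OF p] pos
      by simp
  qed
  have ndvd: "\<not> q dvd card (normalizer G P)" and qp: "Factorial_Ring.prime q"
    if q: "q \<in> PDS_Pi v k lam mu s \<beta>" for q
  proof -
    show qp: "Factorial_Ring.prime q" using q by (simp add: PDS_Pi_def)
    have \<beta>: "\<beta> \<in> {1, 2}" using assms(11,12) by auto
    \<comment> \<open>A prime in both sets would divide the difference of the eigenvalues, which is
      \<open>s\<close> up to sign.\<close>
    have pq: "p \<noteq> q"
    proof
      assume "p = q"
      then have "int p dvd (int k - PDS_theta lam mu s \<alpha>) - (int k - PDS_theta lam mu s \<beta>)"
        using q assms(13) unfolding PDS_Pi_def mem_Collect_eq by (metis dvd_diff)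
      then have "int p dvd PDS_theta lam mu s \<beta> - PDS_theta lam mu s \<alpha>" by simp
      moreover have "PDS_theta lam mu s \<beta> - PDS_theta lam mu s \<alpha> \<in> {s, - s}"
        using PDS_theta_root(1)[OF assms(7,11)] PDS_theta_root(1)[OF assms(7) \<beta>] assms(11,12) by auto
      ultimately show False using assms(10) by auto
    qed
    show "\<not> q dvd card (normalizer G P)"
    proof
      assume "q dvd card (normalizer G P)"
      then obtain y where y: "y \<in> normalizer G P" "y \<noteq> \<one>\<^bsub>G\<^esub>" "y [^]\<^bsub>G\<^esub> q = \<one>\<^bsub>G\<^esub>"
        using exists_element_of_prime_order[OF fin subN qp] by blast
      have yG: "y \<in> carrier G" using y subgroup.subset[OF subN] by auto
      have "y \<otimes>\<^bsub>G\<^esub> x \<otimes>\<^bsub>G\<^esub> inv\<^bsub>G\<^esub> y \<otimes>\<^bsub>G\<^esub> inv\<^bsub>G\<^esub> x \<in> K" if "x \<in> P" for x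
        unfolding K_def derived_def using P.mem_carrier[OF that] yG by (intro generate.incl) auto
      then obtain x where x: "x \<in> P" "x \<noteq> \<one>\<^bsub>G\<^esub>" "y \<otimes>\<^bsub>G\<^esub> x = x \<otimes>\<^bsub>G\<^esub> y"
        using commuting_element_outside_normal[OF fin p qp pq subP cardP K PK y(1,3)] by blast
      have "x [^]\<^bsub>G\<^esub> (p ^ multiplicity p (order G)) = \<one>\<^bsub>G\<^esub>"
        using pow_card_subgroup[OF subP x(1)] unfolding cardP .
      then show False
        using regular_PDS_no_mixed_commuting[OF fin assms(3,7,11,13) _ pq] q x y yG assms(12) by auto
    qed
  qed
  have "coprime (card (normalizer G P)) (PDS_pi v k lam mu s \<beta>)"
    unfolding PDS_pi_def
    using ndvd qp by (intro prod_coprime_right) (auto simp: prime_imp_coprime coprime_commute)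
  moreover have "PDS_pi v k lam mu s \<beta> mod p = 1 mod p" if "solvable G"
  proof -
    \<comment> \<open>Generalized to subsets for the induction; an infinite product has the default
      value 1.\<close>
    have "(\<Prod>q\<in>B. q ^ multiplicity q v) mod p = 1 mod p" if "B \<subseteq> PDS_Pi v k lam mu s \<beta>" for B
      using that
    proof (induction B rule: infinite_finite_induct)
      case (insert q B)
      have "q ^ multiplicity q v mod p = 1 mod p"
        using solvable_prime_part_cong_1[OF fin \<open>solvable G\<close> p qp assms(15) ndvd, of q]
          insert.prems ordG by auto
      moreover have "(\<Prod>q\<in>B. q ^ multiplicity q v) mod p = 1 mod p" using insert by simp
      ultimately show ?case using mod_mult_cong insert.hyps by fastforce
    qed auto
    then show ?thesis unfolding PDS_pi_def by blast
  qed
  ultimately show ?thesis by blast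
qed

end
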